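(* Let $n\ge 1$ and for $i=0,1,\dots,n$ let $$\lambda_i = 1 - \frac{i(2n-i+1)}{n^2},\qquad \pi_i = \frac{\binom{2n}{i}-\binom{2n}{i-1}}{\binom{2n}{n}},$$ with the convention $\binom{2n}{-1}=0$. Let $I$ be a random variable with $P(I=i)=\pi_i$ for $0\le i\le n$, and let $W = n\lambda_I + 1$. Let $Y$ have the exponential distribution with mean $1$, and let $h$ be absolutely continuous with $\|h'\|=\sup_x|h'(x)|<\infty$. Then $$|Eh(W)-Eh(Y)| \le 12\,\|h'\|\, n^{-1/2}.$$
   Context: The numbers $\lambda_i$ with multiplicities $\binom{2n}{i}-\binom{2n}{i-1}$ form the spectrum of the Bernoulli-Laplace Markov chain; $\lambda_I$ is a uniformly chosen eigenvalue counted with multiplicity. *)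

theory Defs
  imports "HOL-Probability.Probability"
begin

text \<open>Eigenvalues of the Bernoulli-Laplace chain: lambda_i = 1 - i(2n-i+1)/n^2.\<close>
definition lambda_BL :: "nat \<Rightarrow> nat \<Rightarrow> real" where
  "lambda_BL n i = 1 - real i * (2 * real n - real i + 1) / (real n)^2"

definition pi_BL :: "nat \<Rightarrow> nat \<Rightarrow> real" where
  "pi_BL n i = (real ((2*n) choose i) - (if i = 0 then 0 else real ((2*n) choose (i - 1))))
               / real ((2*n) choose n)"

definition abs_continuous_on :: "real set \<Rightarrow> (real \<Rightarrow> real) \<Rightarrow> bool" where
  "abs_continuous_on S f \<longleftrightarrow>
     (\<forall>e>0. \<exists>d>0. \<forall>(m::nat) (a::nat \<Rightarrow> real) b.
        (\<forall>k<m. a k \<le> b k \<and> {a k..b k} \<subseteq> S) \<and>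
        disjoint_family_on (\<lambda>k. {a k<..<b k}) {..<m} \<and>
        (\<Sum>k<m. b k - a k) < d \<longrightarrow>
        (\<Sum>k<m. \<bar>f (b k) - f (a k)\<bar>) < e)"

end

theory Submission
  imports Defs
begin

text \<open>
  The law of \<open>W\<close> lives on the points \<open>W\<^sub>k = k (k + 1) / n\<close> with tails
  \<open>p\<^sub>k = P (W \<ge> W\<^sub>k) = C(2n, n - k) / C(2n, n)\<close>. Compare these with the exponential tails
  \<open>q\<^sub>k = exp (- W\<^sub>k)\<close>: both are at most \<open>u\<^sub>k = exp (- k\<^sup>2 / (n + 1/2))\<close>, so
  \<open>\<bar>p\<^sub>k - q\<^sub>k\<bar> \<le> 2 u\<^sub>k - p\<^sub>k - q\<^sub>k\<close>, and summation by parts reduces the theorem to estimating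
  the sums of \<open>p\<^sub>k\<close>, \<open>q\<^sub>k\<close>, \<open>u\<^sub>k\<close> against the weights \<open>W\<^sub>k - W\<^sub>k\<^sub>-\<^sub>1 = 2 k / n\<close>. The first is \<open>E W = 1\<close>;
  the other two are expectations of step functions of \<open>Y\<close> within \<open>O(n\<^sup>-\<^sup>1\<^sup>/\<^sup>2)\<close> of \<open>1\<close>.

  All this only uses that \<open>h\<close> is Lipschitz. The hypothesis bounds the derivative merely where it
  exists, so Lipschitz continuity amounts to Lebesgue's theorem for absolutely continuous functions.
  It is obtained from the Vitali covering theorem without passing through bounded variation: the set
  where difference quotients oscillate between \<open>p\<close> and \<open>q\<close>, and the set where they are unbounded above,
  are null, so almost every point lies in arbitrarily short intervals of slope below any \<open>c > L\<close>.
\<close>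

section \<open>Absolutely continuous functions with bounded derivative\<close>

text \<open>Endpoints are read off the set \<open>K\<close>, so that increments of \<open>f\<close>
  and lengths (increments of the identity) are sums over the same \<open>division_of\<close>
  family.\<close>

definition increment :: "(real \<Rightarrow> 'a::ab_group_add) \<Rightarrow> real set \<Rightarrow> 'a" where
  "increment f K = f (Sup K) - f (Inf K)"

lemma increment_interval [simp]: "u \<le> v \<Longrightarrow> increment f {u..v} = f v - f u"
  by (simp add: increment_def)

text \<open>Tagging every interval with its left endpoint gives a tagged division, over which the
  increments telescope.\<close>

lemma sum_increment_division:
  fixes f :: "real \<Rightarrow> 'a::real_normed_vector"
  assumes "D division_of {a..b}" "a \<le> b"
  shows "(\<Sum>K\<in>D. increment f K) = f b - f a"
proof -
  define p where "p = (\<lambda>K. (Inf K, K)) ` D"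
  have inj: "inj_on (\<lambda>K. (Inf K, K)) D"
    by (auto simp: inj_on_def)
  have box: "\<exists>u v. u \<le> v \<and> K = {u..v}" if KD: "K \<in> D" for K
  proof -
    obtain u v where "K = cbox u v" "K \<noteq> {}"
      using division_ofD(3,4)[OF assms(1) KD] by blast
    then show ?thesis by auto
  qed
  have "p tagged_division_of {a..b}"
  proof (rule tagged_division_ofI)
    show "finite p"
      using assms(1) by (simp add: p_def division_of_finite)
    fix x K assume xK: "(x, K) \<in> p"
    then obtain u v where uv: "u \<le> v" "K = {u..v}" "x = Inf K" "K \<in> D"
      using box by (fastforce simp: p_def)
    then show "x \<in> K" "\<exists>a b. K = cbox a b" "K \<subseteq> {a..b}"
      using division_ofD(2)[OF assms(1), of K] by auto
  next
    fix x1 K1 x2 K2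
    assume "(x1, K1) \<in> p" "(x2, K2) \<in> p" "(x1, K1) \<noteq> (x2, K2)"
    then show "interior K1 \<inter> interior K2 = {}"
      using division_ofD(5)[OF assms(1)] by (fastforce simp: p_def)
  next
    show "\<Union> {K. \<exists>x. (x, K) \<in> p} = {a..b}"
      unfolding p_def division_ofD(6)[OF assms(1), symmetric] by blast
  qed
  from additive_tagged_division_1[OF assms(2) this, of f]
  show ?thesis
    by (simp add: p_def sum.reindex[OF inj] increment_def o_def)
qed

text \<open>Restates the definition for divisions in place of indexed families: enumerate
  \<open>D\<close> by \<open>{..<card D}\<close>; the open intervals of the definition are the
  interiors of the members, which a division keeps disjoint.\<close>

lemma abs_continuous_on_sum_increment:
  assumes ac: "abs_continuous_on {a..b} f" and "e > 0"
  obtains d where "d > 0"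
    "\<And>D. \<lbrakk>D division_of \<Union>D; \<Union>D \<subseteq> {a..b}; (\<Sum>K\<in>D. increment (\<lambda>x. x) K) < d\<rbrakk>
       \<Longrightarrow> (\<Sum>K\<in>D. \<bar>increment f K\<bar>) < e"
proof -
  obtain d where "d > 0" and d: "\<And>(m::nat) (l::nat \<Rightarrow> real) r.
        (\<forall>k<m. l k \<le> r k \<and> {l k..r k} \<subseteq> {a..b}) \<and>
        disjoint_family_on (\<lambda>k. {l k<..<r k}) {..<m} \<and>
        (\<Sum>k<m. r k - l k) < d \<longrightarrow>
        (\<Sum>k<m. \<bar>f (r k) - f (l k)\<bar>) < e"
    using ac \<open>e > 0\<close> unfolding abs_continuous_on_def by meson
  have "(\<Sum>K\<in>D. \<bar>increment f K\<bar>) < e"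
    if D: "D division_of \<Union>D" "\<Union>D \<subseteq> {a..b}" "(\<Sum>K\<in>D. increment (\<lambda>x. x) K) < d" for D
  proof -
    have fin: "finite D"
      using D(1) by blast
    have box: "Inf K \<le> Sup K \<and> K = {Inf K..Sup K}" if KD: "K \<in> D" for K
    proof -
      obtain u v where "K = cbox u v" "K \<noteq> {}"
        using division_ofD(3,4)[OF D(1) KD] by blast
      then show ?thesis by auto
    qed
    obtain g where g: "bij_betw g {..<card D} D"
      using ex_bij_betw_nat_finite[OF fin] by (auto simp: atLeast0LessThan)
    have gD: "g k \<in> D" if "k < card D" for k
      using g that by (auto simp: bij_betw_def)
    have 1: "\<forall>k<card D. Inf (g k) \<le> Sup (g k) \<and> {Inf (g k)..Sup (g k)} \<subseteq> {a..b}"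
      using box gD D(2) by (metis Sup_le_iff)
    have int: "interior K = {Inf K<..<Sup K}" if "K \<in> D" for K
      using box[OF that] by (metis interior_atLeastAtMost_real)
    have 2: "disjoint_family_on (\<lambda>k. {Inf (g k)<..<Sup (g k)}) {..<card D}"
      unfolding disjoint_family_on_def
    proof (intro ballI impI)
      fix k l assume kl: "k \<in> {..<card D}" "l \<in> {..<card D}" "k \<noteq> l"
      then have "g k \<noteq> g l"
        using g by (auto simp: bij_betw_def inj_on_def)
      then have "interior (g k) \<inter> interior (g l) = {}"
        using division_ofD(5)[OF D(1)] gD kl by auto
      then show "{Inf (g k)<..<Sup (g k)} \<inter> {Inf (g l)<..<Sup (g l)} = {}"
        using int gD kl by auto
    qed
    have "(\<Sum>K\<in>D. Sup K - Inf K) < d"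
      using D(3) by (simp add: increment_def)
    then have 3: "(\<Sum>k<card D. Sup (g k) - Inf (g k)) < d"
      using sum.reindex_bij_betw[OF g, of "\<lambda>K. Sup K - Inf K"] by simp
    have "(\<Sum>k<card D. \<bar>f (Sup (g k)) - f (Inf (g k))\<bar>) < e"
      using d[of "card D" "\<lambda>k. Inf (g k)" "\<lambda>k. Sup (g k)"] 1 2 3 by simp
    then show ?thesis
      using sum.reindex_bij_betw[OF g, of "\<lambda>K. \<bar>f (Sup K) - f (Inf K)\<bar>"]
      by (simp add: increment_def)
  qed
  with \<open>d > 0\<close> show ?thesis by (rule that)
qed

section \<open>Vitali covers, nested divisions and null sets of extreme slopes\<close>

text \<open>Vitali's theorem gives countably many disjoint intervals covering \<open>E\<close> up to
  a null set. Their union \<open>U\<close> lies in \<open>G\<close> and so has finite measure; by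
  continuity from below, finitely many of them exhaust \<open>U\<close> up to
  \<open>\<epsilon>\<close>. The set \<open>T\<close> collects both losses, and \<open>P\<close>
  will be a condition on the slope of \<open>f\<close>.\<close>

lemma finite_Vitali_cover:
  fixes E G :: "real set"
  assumes "open G" and G: "G \<in> lmeasurable" and "E \<subseteq> G"
    and fine: "\<And>x d. \<lbrakk>x \<in> E; d > 0\<rbrakk> \<Longrightarrow> \<exists>u v. u < v \<and> u \<le> x \<and> x \<le> v \<and> v - u < d \<and> P u v"
    and "\<epsilon> > 0"
  obtains D T where "D division_of \<Union>D" "\<Union>D \<subseteq> G"
    "\<And>K. K \<in> D \<Longrightarrow> \<exists>u v. K = {u..v} \<and> u < v \<and> P u v"
    "T \<in> lmeasurable" "measure lebesgue T < \<epsilon>" "E \<subseteq> \<Union>D \<union> T"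
proof -
  define \<K> where "\<K> = {(u, v). u < v \<and> P u v \<and> {u..v} \<subseteq> G}"
  \<comment> \<open>The covering theorem speaks of closed balls: an interval is indexed by its pair
    of endpoints and viewed as a ball through its centre and radius.\<close>
  define c where "c = (\<lambda>(u::real, v). (u + v) / 2)"
  define r where "r = (\<lambda>(u::real, v). (v - u) / 2)"
  have cb: "cball (c i) (r i) = {fst i..snd i}" for i
    by (auto simp: c_def r_def split_beta cball_eq_atLeastAtMost field_simps)
  obtain C where C: "countable C" "C \<subseteq> \<K>"
    "pairwise (\<lambda>i j. disjnt (cball (c i) (r i)) (cball (c j) (r j))) C"
    "negligible (E - (\<Union>i\<in>C. cball (c i) (r i)))"
  proof (rule Vitali_covering_theorem_cballs[of \<K> r E c])
    show "0 < r i" if "i \<in> \<K>" for i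
      using that by (auto simp: \<K>_def r_def)
    fix x d :: real assume x: "x \<in> E" and "0 < d"
    then obtain \<delta> where \<delta>: "\<delta> > 0" "ball x \<delta> \<subseteq> G"
      using assms(1,3) by (meson openE subsetD)
    obtain u v where uv: "u < v" "u \<le> x" "x \<le> v" "v - u < min d \<delta>" "P u v"
      using fine[OF x, of "min d \<delta>"] \<delta>(1) \<open>0 < d\<close> by auto
    have "{u..v} \<subseteq> ball x \<delta>"
      using uv by (auto simp: dist_real_def)
    then have "(u, v) \<in> \<K>"
      using uv \<delta> by (auto simp: \<K>_def)
    moreover have "x \<in> cball (c (u, v)) (r (u, v))"
      using uv by (simp add: cb)
    moreover have "r (u, v) < d"
      using uv by (simp add: r_def)
    ultimately show "\<exists>i. i \<in> \<K> \<and> x \<in> cball (c i) (r i) \<and> r i < d"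
      by blast
  qed
  define S where "S i = {fst i..snd i}" for i :: "real \<times> real"
  define U where "U = (\<Union>i\<in>C. S i)"
  have neg: "negligible (E - U)"
    using C(4) by (simp add: U_def S_def cb)
  have disj: "S i \<inter> S j = {}" if "i \<in> C" "j \<in> C" "i \<noteq> j" for i j
    using C(3) that by (auto simp: pairwise_def disjnt_def S_def cb)
  have UG: "U \<subseteq> G"
    using C(2) by (force simp: U_def S_def \<K>_def)
  have Um: "U \<in> lmeasurable"
  proof (rule fmeasurableI2[OF G UG])
    show "U \<in> sets lebesgue"
      unfolding U_def S_def using C(1) by (intro sets.countable_UN') auto
  qed
  obtain F where F: "finite F" "F \<subseteq> C" "measure lebesgue (U - (\<Union>i\<in>F. S i)) < \<epsilon>"
  proof (cases "C = {}")
    case True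
    then show ?thesis using that[of "{}"] \<open>\<epsilon> > 0\<close> by (simp add: U_def)
  next
    case False
    define A where "A n = (\<Union>i\<in>from_nat_into C ` {..n}. S i)" for n
    have ran: "range (from_nat_into C) = C"
      using C(1) False by simp
    have UA: "(\<Union>n. A n) = U"
    proof -
      have "(\<Union>n. A n) = (\<Union>k. S (from_nat_into C k))"
        by (auto simp: A_def)
      also have "\<dots> = (\<Union>i\<in>range (from_nat_into C). S i)"
        by simp
      finally show ?thesis by (simp only: ran U_def)
    qed
    have Am: "A n \<in> sets lebesgue" for n
      unfolding A_def S_def by auto
    have "(\<lambda>n. measure lebesgue (A n)) \<longlonglongrightarrow> measure lebesgue (\<Union>n. A n)"
    proof (rule Lim_measure_incseq)
      show "range A \<subseteq> sets lebesgue" using Am by auto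
      show "incseq A" unfolding A_def by (intro monoI UN_mono image_mono) auto
      show "emeasure lebesgue (\<Union>n. A n) \<noteq> \<infinity>"
        using fmeasurableD2[OF Um] by (simp only: UA infinity_ennreal_def not_False_eq_True)
    qed
    then have "\<forall>\<^sub>F n in sequentially. measure lebesgue U - \<epsilon> < measure lebesgue (A n)"
      unfolding UA using \<open>\<epsilon> > 0\<close> by (intro order_tendstoD(1)) auto
    then obtain n where n: "measure lebesgue U - \<epsilon> < measure lebesgue (A n)"
      by (meson eventually_happens trivial_limit_sequentially)
    have sub: "A n \<subseteq> U" using UA by auto
    have "measure lebesgue (U - A n) = measure lebesgue U - measure lebesgue (A n)"
      using Um sub Am by (intro measurable_measure_Diff) auto
    with n show ?thesis
      using that[of "from_nat_into C ` {..n}"] ran by (auto simp: A_def)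
  qed
  define D where "D = S ` F"
  have SF: "\<exists>u v. S i = {u..v} \<and> u < v \<and> P u v \<and> {u..v} \<subseteq> G" if "i \<in> F" for i
    using that F(2) C(2) by (auto simp: S_def \<K>_def)
  show ?thesis
  proof (rule that[of D "(E - U) \<union> (U - \<Union>D)"])
    show "D division_of \<Union>D"
    proof (rule division_ofI)
      show "finite D" using F(1) by (simp add: D_def)
      fix K assume K: "K \<in> D"
      show "K \<subseteq> \<Union>D" using K by auto
      show "K \<noteq> {}" "\<exists>a b. K = cbox a b"
        using K SF by (fastforce simp: D_def)+
    next
      fix K1 K2 assume "K1 \<in> D" "K2 \<in> D" "K1 \<noteq> K2"
      then obtain i j where "i \<in> F" "j \<in> F" "i \<noteq> j" "K1 = S i" "K2 = S j"
        unfolding D_def by blast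
      then have "K1 \<inter> K2 = {}" using disj[of i j] F(2) by blast
      then show "interior K1 \<inter> interior K2 = {}"
        using interior_subset by blast
    qed simp
    show "\<Union>D \<subseteq> G" using SF by (fastforce simp: D_def)
    show "\<exists>u v. K = {u..v} \<and> u < v \<and> P u v" if "K \<in> D" for K
      using SF that by (fastforce simp: D_def)
    have Dm: "\<Union>D \<in> sets lebesgue"
      using F(1) by (auto simp: D_def S_def)
    show "E - U \<union> (U - \<Union>D) \<in> lmeasurable"
      by (rule fmeasurable.Un[OF negligible_imp_measurable[OF neg] fmeasurable_Diff[OF Um Dm]])
    have "measure lebesgue (E - U \<union> (U - \<Union>D)) \<le> measure lebesgue (E - U) + measure lebesgue (U - \<Union>D)"
      using negligible_imp_measurable[OF neg] Um Dm by (intro measure_Un_le) auto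
    also have "\<dots> < \<epsilon>"
      using F(3) negligible_imp_measure0[OF neg] by (simp add: D_def)
    finally show "measure lebesgue (E - U \<union> (U - \<Union>D)) < \<epsilon>" .
    show "E \<subseteq> \<Union>D \<union> (E - U \<union> (U - \<Union>D))" by auto
  qed
qed

lemma sum_length_division:
  assumes "D division_of \<Union>D"
  shows "(\<Sum>K\<in>D. increment (\<lambda>x. x) K) = measure lebesgue (\<Union>D)"
proof -
  have "increment (\<lambda>x. x) K = measure lebesgue K" if KD: "K \<in> D" for K
  proof -
    obtain u v where "K = cbox u v" "K \<noteq> {}"
      using division_ofD(3,4)[OF assms KD] by blast
    then show ?thesis by auto
  qed
  then show ?thesis
    using content_division[OF assms] by simp
qed

text \<open>Extend \<open>D1\<close> to a division of \<open>{a..b}\<close> by adding intervals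
  \<open>H\<close>, then extend \<open>D2 \<union> H\<close> by adding \<open>R\<close>. Both
  divisions have total increment \<open>g b - g a\<close>, so the part over \<open>H\<close>
  cancels. One \<open>R\<close> serves all \<open>g\<close>, hence both \<open>f\<close> and
  length.\<close>

lemma nested_division_remainder:
  assumes D1: "D1 division_of \<Union>D1" "\<Union>D1 \<subseteq> {a..b}" and "a \<le> b"
    and D2: "D2 division_of \<Union>D2" "\<Union>D2 \<subseteq> (\<Union>K\<in>D1. interior K)"
    and ne: "\<And>K. K \<in> D2 \<Longrightarrow> interior K \<noteq> {}"
  obtains R where "R division_of \<Union>R" "\<Union>R \<subseteq> {a..b}"
    "\<And>g::real \<Rightarrow> real. (\<Sum>K\<in>D1. increment g K) = (\<Sum>K\<in>D2. increment g K) + (\<Sum>K\<in>R. increment g K)"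
proof -
  obtain Q1 where Q1: "D1 \<subseteq> Q1" "Q1 division_of {a..b}"
    using partial_division_extend_interval[OF D1(1), of a b] D1(2) by auto
  define H where "H = Q1 - D1"
  have disj: "K2 \<inter> interior K = {}" if "K2 \<in> D2" "K \<in> H" for K K2
  proof -
    have "interior K \<inter> interior K1 = {}" if "K1 \<in> D1" for K1
      using division_ofD(5)[OF Q1(2)] \<open>K \<in> H\<close> that Q1(1) by (auto simp: H_def)
    then show ?thesis
      using D2(2) \<open>K2 \<in> D2\<close> by blast
  qed
  \<comment> \<open>A common member would be disjoint from its own interior, so its interior would
    be empty, against \<open>ne\<close>.\<close>
  have DH: "D2 \<inter> H = {}"
  proof (rule ccontr)
    assume "D2 \<inter> H \<noteq> {}"
    then obtain K where "K \<in> D2" "K \<in> H" by auto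
    then show False
      using disj[of K K] ne[of K] interior_subset[of K] by blast
  qed
  have Hdiv: "H division_of \<Union>H"
    by (rule division_of_subset[OF division_of_union_self[OF Q1(2)]]) (auto simp: H_def)
  have "interior K1 \<inter> interior K2 = {}"
    if "K1 \<in> D2 \<union> H" "K2 \<in> D2 \<union> H" "K1 \<noteq> K2" for K1 K2
    using that disj[of K1 K2] disj[of K2 K1] division_ofD(5)[OF D2(1), of K1 K2]
      division_ofD(5)[OF Hdiv, of K1 K2] interior_subset[of K1] interior_subset[of K2] by blast
  moreover have "K \<noteq> {} \<and> (\<exists>a b. K = cbox a b)" if "K \<in> D2 \<union> H" for K
    using that division_ofD(3,4)[OF D2(1)] division_ofD(3,4)[OF Hdiv] by blast
  ultimately have "(D2 \<union> H) division_of \<Union>(D2 \<union> H)"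
    using division_ofD(1)[OF D2(1)] division_ofD(1)[OF Hdiv] unfolding division_of_def by blast
  moreover have "\<Union>(D2 \<union> H) \<subseteq> {a..b}"
  proof -
    have "\<Union>D2 \<subseteq> \<Union>D1"
    proof -
      have "(\<Union>K\<in>D1. interior K) \<subseteq> \<Union>D1"
        using interior_subset by fast
      with D2(2) show ?thesis by (rule order_trans)
    qed
    moreover have "\<Union>H \<subseteq> {a..b}"
      using division_ofD(6)[OF Q1(2)] by (auto simp: H_def)
    ultimately show ?thesis using D1(2) by auto
  qed
  ultimately obtain Q2 where Q2: "D2 \<union> H \<subseteq> Q2" "Q2 division_of {a..b}"
    using partial_division_extend_interval[of "D2 \<union> H" a b] by auto
  define R where "R = Q2 - (D2 \<union> H)"
  show ?thesis
  proof (rule that[of R])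
    show "R division_of \<Union>R"
      by (rule division_of_subset[OF division_of_union_self[OF Q2(2)]]) (auto simp: R_def)
    show "\<Union>R \<subseteq> {a..b}"
      using division_ofD(6)[OF Q2(2)] by (auto simp: R_def)
    fix g :: "real \<Rightarrow> real"
    have fin: "finite Q1" "finite Q2"
      using Q1(2) Q2(2) by auto
    have "(\<Sum>K\<in>Q1. increment g K) = (\<Sum>K\<in>H. increment g K) + (\<Sum>K\<in>D1. increment g K)"
      unfolding H_def by (rule sum.subset_diff[OF Q1(1) fin(1)])
    moreover have "(\<Sum>K\<in>Q2. increment g K) = (\<Sum>K\<in>R. increment g K) + (\<Sum>K\<in>D2 \<union> H. increment g K)"
      unfolding R_def by (rule sum.subset_diff[OF Q2(1) fin(2)])
    moreover have "(\<Sum>K\<in>D2 \<union> H. increment g K) = (\<Sum>K\<in>D2. increment g K) + (\<Sum>K\<in>H. increment g K)"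
      using DH D2(1) Hdiv by (intro sum.union_disjoint) auto
    ultimately show "(\<Sum>K\<in>D1. increment g K) = (\<Sum>K\<in>D2. increment g K) + (\<Sum>K\<in>R. increment g K)"
      using sum_increment_division[OF Q1(2) \<open>a \<le> b\<close>, of g]
        sum_increment_division[OF Q2(2) \<open>a \<le> b\<close>, of g] by simp
  qed
qed

text \<open>Take intervals of slope at most \<open>p\<close> covering almost all of \<open>E\<close> with almost no excess length,
  and inside them intervals of slope at least \<open>q\<close>, again covering almost all of \<open>E\<close>. What is left
  between the two families is short, yet has to carry an increment of about
  \<open>(q - p)\<close> times the outer measure \<open>s\<close> of \<open>E\<close>; absolute continuity forces \<open>s = 0\<close>.\<close>
lemma negligible_oscillating_slopes:
  fixes f :: "real \<Rightarrow> real"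
  assumes ac: "abs_continuous_on {a..b} f" and "a \<le> b" and "p < q" and E: "E \<subseteq> {a<..<b}"
    and low: "\<And>x d. \<lbrakk>x \<in> E; d > 0\<rbrakk>
      \<Longrightarrow> \<exists>u v. u < v \<and> u \<le> x \<and> x \<le> v \<and> v - u < d \<and> f v - f u \<le> p * (v - u)"
    and high: "\<And>x d. \<lbrakk>x \<in> E; d > 0\<rbrakk>
      \<Longrightarrow> \<exists>u v. u < v \<and> u \<le> x \<and> x \<le> v \<and> v - u < d \<and> q * (v - u) \<le> f v - f u"
  shows "negligible E"
proof -
  \<comment> \<open>Since \<open>E\<close> is not known to be measurable, its outer measure
    \<open>s\<close> is taken as an infimum over measurable supersets.\<close>
  define M where "M = {measure lebesgue T | T. T \<in> lmeasurable \<and> E \<subseteq> T}"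
  define s where "s = Inf M"
  have bdd: "bdd_below M"
    by (rule bdd_belowI[of _ 0]) (auto simp: M_def)
  have Mne: "M \<noteq> {}"
    using E by (auto simp: M_def intro!: exI[of _ "{a<..<b}"])
  have s_le: "s \<le> measure lebesgue T" if "T \<in> lmeasurable" "E \<subseteq> T" for T
    unfolding s_def using that by (intro cInf_lower[OF _ bdd]) (auto simp: M_def)
  have near: "\<exists>T. T \<in> lmeasurable \<and> E \<subseteq> T \<and> measure lebesgue T < s + e" if "e > 0" for e
    using cInf_lessD[OF Mne, of "s + e"] that by (auto simp: s_def M_def)
  have s_small: "s \<le> e" if "e > 0" for e
  proof -
    have epq: "e * (q - p) / 2 > 0"
      using \<open>e > 0\<close> \<open>p < q\<close> by simp
    obtain d where "d > 0" and d: "\<And>D. \<lbrakk>D division_of \<Union>D; \<Union>D \<subseteq> {a..b};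
        (\<Sum>K\<in>D. increment (\<lambda>x. x) K) < d\<rbrakk> \<Longrightarrow> (\<Sum>K\<in>D. \<bar>increment f K\<bar>) < e * (q - p) / 2"
      by (rule abs_continuous_on_sum_increment[OF ac epq]) (rule that, assumption+)
    \<comment> \<open>The remainder will have length at most \<open>3 * \<epsilon>\<close>. The
      first bound makes this less than \<open>d\<close>, the last makes \<open>p\<close> times it at
      most \<open>e * (q - p) / 4\<close>, and the middle one absorbs the loss
      \<open>2 * \<epsilon>\<close> in \<open>s \<le> l2 + 2 * \<epsilon>\<close>.\<close>
    define \<epsilon> where "\<epsilon> = min (d / 4) (min (e / 8) (e * (q - p) / (12 * (\<bar>p\<bar> + 1))))"
    have \<epsilon>: "\<epsilon> > 0" "\<epsilon> \<le> d / 4" "\<epsilon> \<le> e / 8" "\<epsilon> \<le> e * (q - p) / (12 * (\<bar>p\<bar> + 1))"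
      unfolding \<epsilon>_def
      using \<open>d > 0\<close> \<open>e > 0\<close> \<open>p < q\<close> by (simp_all add: min_le_iff_disj del: divide_le_eq_numeral1 le_divide_eq_numeral1)
    obtain T0 where T0: "T0 \<in> lmeasurable" "E \<subseteq> T0" "measure lebesgue T0 < s + \<epsilon> / 2"
      using near[of "\<epsilon> / 2"] \<epsilon>(1) by auto
    obtain G0 where G0: "open G0" "T0 \<subseteq> G0" "G0 - T0 \<in> lmeasurable"
        "emeasure lebesgue (G0 - T0) < ennreal (\<epsilon> / 2)"
      using sets_lebesgue_outer_open[OF fmeasurableD[OF T0(1)], of "\<epsilon> / 2"] \<epsilon>(1) by auto
    have G0_split: "G0 = (G0 - T0) \<union> T0"
      using G0(2) by auto
    have G0m: "G0 \<in> lmeasurable"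
      using fmeasurable.Un[OF G0(3) T0(1)] G0_split by simp
    have "measure lebesgue (G0 - T0) < \<epsilon> / 2"
      using G0(3,4) \<epsilon>(1) by (simp add: emeasure_eq_measure2 ennreal_less_iff)
    moreover have "measure lebesgue G0 \<le> measure lebesgue (G0 - T0) + measure lebesgue T0"
      using measure_Un_le[of "G0 - T0" lebesgue T0] G0(3) T0(1) G0_split by auto
    ultimately have G0_less: "measure lebesgue G0 < measure lebesgue T0 + \<epsilon> / 2"
      by linarith
    define G where "G = G0 \<inter> {a<..<b}"
    have G: "open G" "G \<in> lmeasurable" "E \<subseteq> G" "G \<subseteq> {a..b}"
      using G0 G0m T0(2) E by (auto simp: G_def)
    have mG: "measure lebesgue G \<le> s + \<epsilon>"
    proof -
      have "measure lebesgue G \<le> measure lebesgue G0"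
        using G0m G by (intro measure_mono_fmeasurable) (auto simp: G_def)
      then show ?thesis using G0_less T0(3) by linarith
    qed
    obtain D1 T1 where D1: "D1 division_of \<Union>D1" "\<Union>D1 \<subseteq> G"
        "\<And>K. K \<in> D1 \<Longrightarrow> \<exists>u v. K = {u..v} \<and> u < v \<and> f v - f u \<le> p * (v - u)"
        "T1 \<in> lmeasurable" "measure lebesgue T1 < \<epsilon>" "E \<subseteq> \<Union>D1 \<union> T1"
      using finite_Vitali_cover[OF G(1-3) low \<epsilon>(1)] by metis
    \<comment> \<open>Covering inside the interiors puts each interval of \<open>D2\<close> strictly
      inside one of \<open>D1\<close>. Only the finitely many endpoints \<open>N\<close> are
      lost.\<close>
    define X where "X = (\<Union>K\<in>D1. interior K)"
    have X: "open X" "X \<subseteq> \<Union>D1"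
      using interior_subset by (auto simp: X_def)
    have Xm: "X \<in> lmeasurable"
      using fmeasurableI2[OF G(2), of X] X D1(2) by auto
    have high': "\<exists>u v. u < v \<and> u \<le> x \<and> x \<le> v \<and> v - u < d \<and> q * (v - u) \<le> f v - f u"
      if "x \<in> E \<inter> X" "d > 0" for x d
      using high that by auto
    obtain D2 T2 where D2: "D2 division_of \<Union>D2" "\<Union>D2 \<subseteq> X"
        "\<And>K. K \<in> D2 \<Longrightarrow> \<exists>u v. K = {u..v} \<and> u < v \<and> q * (v - u) \<le> f v - f u"
        "T2 \<in> lmeasurable" "measure lebesgue T2 < \<epsilon>" "E \<inter> X \<subseteq> \<Union>D2 \<union> T2"
      using finite_Vitali_cover[OF X(1) Xm Int_lower2 high' \<epsilon>(1)] by metis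
    have neD2: "interior K \<noteq> {}" if "K \<in> D2" for K
      using D2(3)[OF that] by auto
    have D1ab: "\<Union>D1 \<subseteq> {a..b}" using D1(2) G(4) by auto
    obtain R where R: "R division_of \<Union>R" "\<Union>R \<subseteq> {a..b}"
      "\<And>g::real \<Rightarrow> real. (\<Sum>K\<in>D1. increment g K) = (\<Sum>K\<in>D2. increment g K) + (\<Sum>K\<in>R. increment g K)"
      using nested_division_remainder[OF D1(1) D1ab \<open>a \<le> b\<close> D2(1) D2(2)[unfolded X_def] neD2] by metis
    define l1 where "l1 = (\<Sum>K\<in>D1. increment (\<lambda>x. x) K)"
    define l2 where "l2 = (\<Sum>K\<in>D2. increment (\<lambda>x. x) K)"
    define lR where "lR = (\<Sum>K\<in>R. increment (\<lambda>x. x) K)"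
    have l_eq: "l1 = l2 + lR"
      unfolding l1_def l2_def lR_def by (rule R(3))
    have l1: "l1 \<le> s + \<epsilon>"
    proof -
      have "l1 = measure lebesgue (\<Union>D1)"
        unfolding l1_def by (rule sum_length_division[OF D1(1)])
      also have "\<dots> \<le> measure lebesgue G"
        using D1(1,2) G(2) by (intro measure_mono_fmeasurable) (auto dest: lmeasurable_division)
      finally show ?thesis using mG by linarith
    qed
    have l2: "s \<le> l2 + 2 * \<epsilon>"
    proof -
      define N where "N = (\<Union>K\<in>D1. {Inf K, Sup K})"
      have "finite N"
        using D1(1) by (auto simp: N_def)
      then have N: "negligible N" by (rule negligible_finite)
      have "\<Union>D1 \<subseteq> X \<union> N"
      proof
        fix x assume "x \<in> \<Union>D1"
        then obtain K where K: "K \<in> D1" "x \<in> K" by auto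
        then obtain u v where "K = {u..v}" "u < v" using D1(3) by blast
        then show "x \<in> X \<union> N"
          using K by (force simp: X_def N_def)
      qed
      then have cov: "E \<subseteq> \<Union>D2 \<union> (T1 \<union> (T2 \<union> N))"
        using D1(6) D2(6) by blast
      have m: "\<Union>D2 \<in> lmeasurable" "T1 \<in> lmeasurable" "T2 \<in> lmeasurable" "N \<in> lmeasurable"
        using D1 D2 N by (auto dest: lmeasurable_division simp: negligible_imp_measurable)
      have "s \<le> measure lebesgue (\<Union>D2 \<union> (T1 \<union> (T2 \<union> N)))"
        using m cov by (intro s_le fmeasurable.Un) auto
      also have "\<dots> \<le> measure lebesgue (\<Union>D2) + measure lebesgue (T1 \<union> (T2 \<union> N))"
        using m by (intro measure_Un_le) auto
      also have "measure lebesgue (T1 \<union> (T2 \<union> N)) \<le> measure lebesgue T1 + measure lebesgue (T2 \<union> N)"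
        using m by (intro measure_Un_le) auto
      also have "measure lebesgue (T2 \<union> N) \<le> measure lebesgue T2 + measure lebesgue N"
        using m by (intro measure_Un_le) auto
      finally show ?thesis
        using D1(5) D2(5) negligible_imp_measure0[OF N] sum_length_division[OF D2(1)]
        by (simp add: l2_def)
    qed
    have lR: "lR < d" "lR \<le> 3 * \<epsilon>" "0 \<le> lR"
    proof -
      show "lR \<le> 3 * \<epsilon>" using l_eq l1 l2 by linarith
      then show "lR < d" using \<epsilon> by linarith
      show "0 \<le> lR" unfolding lR_def sum_length_division[OF R(1)] by simp
    qed
    have "(\<Sum>K\<in>D1. increment f K) \<le> (\<Sum>K\<in>D1. p * increment (\<lambda>x. x) K)"
      by (rule sum_mono) (use D1(3) in fastforce)
    then have f1: "(\<Sum>K\<in>D1. increment f K) \<le> p * l1"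
      by (simp add: l1_def sum_distrib_left)
    have "(\<Sum>K\<in>D2. q * increment (\<lambda>x. x) K) \<le> (\<Sum>K\<in>D2. increment f K)"
      by (rule sum_mono) (use D2(3) in fastforce)
    then have f2: "q * l2 \<le> (\<Sum>K\<in>D2. increment f K)"
      by (simp add: l2_def sum_distrib_left)
    have fR: "\<bar>\<Sum>K\<in>R. increment f K\<bar> < e * (q - p) / 2"
      using d[OF R(1,2)] lR(1) sum_abs[of "increment f" R] unfolding lR_def by linarith
    \<comment> \<open>The increment over \<open>D1\<close> is at most \<open>p * l1\<close>, yet
      equals the increment over \<open>D2\<close>, at least \<open>q * l2\<close>, plus that over
      \<open>R\<close>, which is small because \<open>R\<close> is short.\<close>
    have "q * l2 \<le> p * l1 + e * (q - p) / 2"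
      using f1 f2 fR R(3)[of f] by linarith
    then have "(q - p) * l2 \<le> p * lR + e * (q - p) / 2"
      by (simp add: l_eq algebra_simps)
    also have "p * lR \<le> (\<bar>p\<bar> + 1) * (3 * \<epsilon>)"
      using lR \<epsilon>(1) by (intro mult_mono) auto
    also have "(\<bar>p\<bar> + 1) * (3 * \<epsilon>) \<le> e * (q - p) / 4"
      using \<epsilon>(4) by (simp add: field_simps)
    finally have "(q - p) * l2 \<le> (q - p) * (3 / 4 * e)"
      by (simp add: algebra_simps)
    then have "l2 \<le> 3 / 4 * e"
      using \<open>p < q\<close> by simp
    then show ?thesis using l2 \<epsilon>(3) by linarith
  qed
  show ?thesis
    unfolding negligible_outer_le
  proof (intro allI impI)
    fix e :: real assume "e > 0"
    then obtain T where "T \<in> lmeasurable" "E \<subseteq> T" "measure lebesgue T < s + e / 2"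
      using near[of "e / 2"] by auto
    then show "\<exists>T. E \<subseteq> T \<and> T \<in> lmeasurable \<and> measure lebesgue T \<le> e"
      using s_small[of "e / 2"] \<open>e > 0\<close> by (intro exI[of _ T]) auto
  qed
qed

text \<open>Disjoint intervals of slope at least \<open>q\<close> have total length at most
  \<open>B / q\<close>, since the variation is at most \<open>B\<close>; here \<open>q\<close> may
  be taken as large as desired.\<close>

lemma negligible_infinite_slopes:
  fixes f :: "real \<Rightarrow> real"
  assumes bv: "\<And>D. \<lbrakk>D division_of \<Union>D; \<Union>D \<subseteq> {a..b}\<rbrakk> \<Longrightarrow> (\<Sum>K\<in>D. \<bar>increment f K\<bar>) \<le> B"
    and E: "E \<subseteq> {a<..<b}"
    and high: "\<And>x d q. \<lbrakk>x \<in> E; d > 0\<rbrakk>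
      \<Longrightarrow> \<exists>u v. u < v \<and> u \<le> x \<and> x \<le> v \<and> v - u < d \<and> q * (v - u) \<le> f v - f u"
  shows "negligible E"
  unfolding negligible_outer_le
proof (intro allI impI)
  fix e :: real assume e: "e > 0"
  \<comment> \<open>Chosen so that \<open>(\<bar>B\<bar> + 1) / q = e / 2\<close>; the
    \<open>1\<close> keeps \<open>q\<close> positive.\<close>
  define q where "q = 2 * (\<bar>B\<bar> + 1) / e"
  have q: "q > 0" using e by (simp add: q_def)
  have ab: "open {a<..<b}" "{a<..<b} \<in> lmeasurable" by auto
  obtain D T where D: "D division_of \<Union>D" "\<Union>D \<subseteq> {a<..<b}"
      "\<And>K. K \<in> D \<Longrightarrow> \<exists>u v. K = {u..v} \<and> u < v \<and> q * (v - u) \<le> f v - f u"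
      "T \<in> lmeasurable" "measure lebesgue T < e / 2" "E \<subseteq> \<Union>D \<union> T"
    using finite_Vitali_cover[OF ab E high half_gt_zero[OF e], of q] by metis
  have "q * measure lebesgue (\<Union>D) = (\<Sum>K\<in>D. q * increment (\<lambda>x. x) K)"
    by (simp add: sum_length_division[OF D(1)] flip: sum_distrib_left)
  also have "\<dots> \<le> (\<Sum>K\<in>D. \<bar>increment f K\<bar>)"
    by (rule sum_mono) (use D(3) in fastforce)
  also have "\<dots> \<le> B"
  proof (rule bv[OF D(1)])
    show "\<Union>D \<subseteq> {a..b}" using D(2) by fastforce
  qed
  finally have "measure lebesgue (\<Union>D) \<le> B / q"
    using q by (simp add: field_simps)
  also have "\<dots> \<le> (\<bar>B\<bar> + 1) / q"
    using q by (intro divide_right_mono) auto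
  also have "\<dots> = e / 2"
    using e by (simp add: q_def field_simps)
  finally have m: "measure lebesgue (\<Union>D) \<le> e / 2" .
  have Dm: "\<Union>D \<in> lmeasurable" using D(1) by (rule lmeasurable_division)
  have "measure lebesgue (\<Union>D \<union> T) \<le> measure lebesgue (\<Union>D) + measure lebesgue T"
    using D Dm by (intro measure_Un_le) auto
  then show "\<exists>T. E \<subseteq> T \<and> T \<in> lmeasurable \<and> measure lebesgue T \<le> e"
    using m D Dm by (intro exI[of _ "\<Union>D \<union> T"]) auto
qed

section \<open>From difference quotients to the Lipschitz bound\<close>

text \<open>A difference quotient at \<open>x\<close> is the slope of an interval with
  \<open>x\<close> as an endpoint; its symmetry in \<open>x\<close> and \<open>y\<close> treats both
  sides alike.\<close>

lemma frequently_slope: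
  fixes f :: "real \<Rightarrow> real"
  assumes "\<exists>\<^sub>F y in at x. Q ((f y - f x) / (y - x))" "d > 0"
  shows "\<exists>u v. u < v \<and> u \<le> x \<and> x \<le> v \<and> v - u < d \<and> Q ((f v - f u) / (v - u))"
proof -
  obtain y where y: "y \<noteq> x" "dist y x < d" "Q ((f y - f x) / (y - x))"
    using assms unfolding frequently_at by blast
  show ?thesis
  proof (cases "x < y")
    case True
    then show ?thesis
      using y by (intro exI[of _ x] exI[of _ y]) (auto simp: dist_real_def)
  next
    case False
    moreover have "(f x - f y) / (x - y) = (f y - f x) / (y - x)"
      by (metis minus_diff_eq minus_divide_divide)
    ultimately show ?thesis
      using y by (intro exI[of _ y] exI[of _ x]) (auto simp: dist_real_def)
  qed
qed

text \<open>Compare the lower and upper limits of the quotients in \<open>ereal\<close>. If they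
  differ, rationals fit between them. If they agree, the common value is not finite, as
  \<open>f\<close> would be differentiable, nor minus infinity, because of \<open>c\<close>; so it
  is plus infinity.\<close>

lemma not_differentiable_slopes:
  fixes f :: "real \<Rightarrow> real"
  assumes nd: "\<not> f differentiable (at x)"
    and lb: "\<forall>\<^sub>F y in at x. c \<le> (f y - f x) / (y - x)"
  shows "(\<exists>p q. p \<in> \<rat> \<and> q \<in> \<rat> \<and> p < q \<and>
            (\<exists>\<^sub>F y in at x. (f y - f x) / (y - x) < p) \<and> (\<exists>\<^sub>F y in at x. q < (f y - f x) / (y - x)))
         \<or> (\<forall>q. \<exists>\<^sub>F y in at x. q < (f y - f x) / (y - x))"
proof -
  define \<phi> where "\<phi> y = (f y - f x) / (y - x)" for y
  define l where "l = Liminf (at x) (\<lambda>y. ereal (\<phi> y))"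
  define u where "u = Limsup (at x) (\<lambda>y. ereal (\<phi> y))"
  have lu: "l \<le> u"
    unfolding l_def u_def by (rule Liminf_le_Limsup) simp
  have low: "\<exists>\<^sub>F y in at x. \<phi> y < p" if "l < ereal p" for p
  proof (rule ccontr)
    assume "\<not> (\<exists>\<^sub>F y in at x. \<phi> y < p)"
    then have "\<forall>\<^sub>F y in at x. ereal p \<le> ereal (\<phi> y)"
      by (simp add: frequently_def not_less)
    then have "ereal p \<le> l" unfolding l_def by (rule Liminf_bounded)
    with that show False by simp
  qed
  have high: "\<exists>\<^sub>F y in at x. q < \<phi> y" if "ereal q < u" for q
  proof (rule ccontr)
    assume "\<not> (\<exists>\<^sub>F y in at x. q < \<phi> y)"
    then have "\<forall>\<^sub>F y in at x. ereal (\<phi> y) \<le> ereal q"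
      by (simp add: frequently_def not_less)
    then have "u \<le> ereal q" unfolding u_def by (rule Limsup_bounded)
    with that show False by simp
  qed
  have cl: "ereal c \<le> l"
    unfolding l_def using lb by (intro Liminf_bounded) (simp add: \<phi>_def)
  show ?thesis
  proof (cases "l = u")
    case True
    have lim: "((\<lambda>y. ereal (\<phi> y)) \<longlongrightarrow> l) (at x)"
      using True by (subst tendsto_iff_Liminf_eq_Limsup) (auto simp: l_def u_def)
    show ?thesis
    proof (cases l)
      case (real r)
      then have "(\<phi> \<longlongrightarrow> r) (at x)" using lim by simp
      then have "(f has_field_derivative r) (at x)"
        by (simp add: has_field_derivative_iff \<phi>_def[abs_def])
      then have False
        using nd real_differentiable_def by blast
      then show ?thesis ..
    next
      case PInf
      then show ?thesis using high True by (auto simp: \<phi>_def)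
    next
      case MInf
      then show ?thesis using cl by simp
    qed
  next
    case False
    then have "l < u" using lu by simp
    then obtain r where r: "l < ereal r" "ereal r < u"
      by (meson ereal_dense2)
    obtain r' where r': "ereal r < ereal r'" "ereal r' < u"
      using r(2) by (meson ereal_dense2)
    then obtain p where p: "p \<in> \<rat>" "r < p" "p < r'"
      by (meson Rats_dense_in_real less_ereal.simps(1))
    then obtain q where q: "q \<in> \<rat>" "p < q" "q < r'"
      by (meson Rats_dense_in_real)
    have "l < ereal p" "ereal q < u"
      using r r' p q by (meson less_ereal.simps(1) order.strict_trans)+
    then show ?thesis
      using low high p q unfolding \<phi>_def by blast
  qed
qed

text \<open>Almost every point lies in \<open>S\<close>, so finitely many disjoint intervals of
  slope at most \<open>c\<close> nearly fill \<open>{a..b}\<close>. The remainder is short and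
  contributes little by absolute continuity.\<close>

lemma bounded_variation_increment_le:
  fixes f :: "real \<Rightarrow> real"
  assumes ac: "abs_continuous_on {a..b} f" and "a \<le> b"
    and bv: "\<And>D. \<lbrakk>D division_of \<Union>D; \<Union>D \<subseteq> {a..b}\<rbrakk> \<Longrightarrow> (\<Sum>K\<in>D. \<bar>increment f K\<bar>) \<le> B"
    and der: "\<And>x. \<lbrakk>x \<in> {a<..<b}; f differentiable (at x)\<rbrakk> \<Longrightarrow> deriv f x \<le> L"
    and "L < c"
  shows "f b - f a \<le> c * (b - a)"
proof (cases "a = b")
  case False
  then have "a < b" using \<open>a \<le> b\<close> by simp
  define \<phi> where "\<phi> x y = (f y - f x) / (y - x)" for x y
  define S where "S = {x \<in> {a<..<b}. \<exists>\<^sub>F y in at x. \<phi> x y < c}"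
  define E where "E p q = {x \<in> {a<..<b}. (\<exists>\<^sub>F y in at x. \<phi> x y < p) \<and> (\<exists>\<^sub>F y in at x. q < \<phi> x y)}" for p q
  define F where "F = {x \<in> {a<..<b}. \<forall>q. \<exists>\<^sub>F y in at x. q < \<phi> x y}"
  have slope_le: "\<exists>u v. u < v \<and> u \<le> x \<and> x \<le> v \<and> v - u < d \<and> f v - f u \<le> p * (v - u)"
    if "\<exists>\<^sub>F y in at x. \<phi> x y < p" "d > 0" for x d p
    using frequently_slope[of "\<lambda>t. t < p" f x d] that
    by (fastforce simp: \<phi>_def divide_less_eq)
  have slope_ge: "\<exists>u v. u < v \<and> u \<le> x \<and> x \<le> v \<and> v - u < d \<and> q * (v - u) \<le> f v - f u"
    if "\<exists>\<^sub>F y in at x. q < \<phi> x y" "d > 0" for x d q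
    using frequently_slope[of "\<lambda>t. q < t" f x d] that
    by (fastforce simp: \<phi>_def less_divide_eq)
  have negE: "negligible (E p q)" if "p < q" for p q
    by (rule negligible_oscillating_slopes[OF ac \<open>a \<le> b\<close> that])
      (auto simp: E_def intro!: slope_le slope_ge)
  have negF: "negligible F"
    by (rule negligible_infinite_slopes[OF bv]) (auto simp: F_def intro!: slope_ge)
  \<comment> \<open>Rational \<open>p\<close> and \<open>q\<close> keep the union countable. The
    endpoints are added because \<open>S\<close>, \<open>E\<close> and \<open>F\<close> contain
    interior points only.\<close>
  define N where "N = (\<Union>(p, q) \<in> {(p, q). p \<in> \<rat> \<and> q \<in> \<rat> \<and> p < q}. E p q) \<union> F \<union> {a, b}"
  have "countable (\<rat> \<times> \<rat> :: (real \<times> real) set)"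
    by (intro countable_SIGMA countable_rat)
  then have "countable {(p, q). p \<in> \<rat> \<and> q \<in> \<rat> \<and> p < (q::real)}"
    by (rule countable_subset[rotated]) auto
  then have negN: "negligible N"
    unfolding N_def using negE negF
    by (intro negligible_Un negligible_countable_Union) auto
  have cov: "{a..b} \<subseteq> S \<union> N"
  proof
    fix x assume x: "x \<in> {a..b}"
    show "x \<in> S \<union> N"
    proof (cases "x \<in> S \<or> x \<in> {a, b}")
      case True then show ?thesis by (auto simp: N_def)
    next
      case False
      then have xab: "x \<in> {a<..<b}" using x by auto
      \<comment> \<open>This bound serves twice: a derivative at \<open>x\<close> would be at least
        \<open>c > L\<close>, and without a derivative the quotients cannot tend to minus
        infinity.\<close>
      have lb: "\<forall>\<^sub>F y in at x. c \<le> \<phi> x y"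
        using False xab by (simp add: S_def frequently_def not_less)
      have nd: "\<not> f differentiable (at x)"
      proof
        assume d: "f differentiable (at x)"
        then have "(\<phi> x \<longlongrightarrow> deriv f x) (at x)"
          by (simp add: \<phi>_def[abs_def] DERIV_deriv_iff_real_differentiable flip: has_field_derivative_iff)
        then have "c \<le> deriv f x"
          using lb by (rule tendsto_lowerbound) simp
        then show False using der[OF xab d] \<open>L < c\<close> by simp
      qed
      from not_differentiable_slopes[OF nd lb[unfolded \<phi>_def], folded \<phi>_def]
      consider p q where "p \<in> \<rat>" "q \<in> \<rat>" "p < q" "x \<in> E p q" | "x \<in> F"
        using xab unfolding E_def F_def by blast
      then show ?thesis by cases (auto simp: N_def)
    qed
  qed
  have main: "f b - f a \<le> c * (b - a) + e" if "e > 0" for e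
  proof -
    obtain d where "d > 0" and d: "\<And>D. \<lbrakk>D division_of \<Union>D; \<Union>D \<subseteq> {a..b};
        (\<Sum>K\<in>D. increment (\<lambda>x. x) K) < d\<rbrakk> \<Longrightarrow> (\<Sum>K\<in>D. \<bar>increment f K\<bar>) < e / 2"
      by (rule abs_continuous_on_sum_increment[OF ac half_gt_zero[OF \<open>e > 0\<close>]]) (rule that, assumption+)
    \<comment> \<open>A remainder shorter than \<open>d\<close> has variation below
      \<open>e / 2\<close>; the second bound limits the error of replacing \<open>c * lD\<close> by
      \<open>c * (b - a)\<close> to \<open>e / 2\<close>.\<close>
    define \<epsilon> where "\<epsilon> = min d (e / (2 * (\<bar>c\<bar> + 1)))"
    have \<epsilon>: "\<epsilon> > 0" "\<epsilon> \<le> d" "\<epsilon> \<le> e / (2 * (\<bar>c\<bar> + 1))"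
      unfolding \<epsilon>_def
      using \<open>d > 0\<close> \<open>e > 0\<close> by (simp_all add: min_le_iff_disj)
    have ab: "open {a<..<b}" "{a<..<b} \<in> lmeasurable" by auto
    have S: "S \<subseteq> {a<..<b}" by (auto simp: S_def)
    have fineS: "\<exists>u v. u < v \<and> u \<le> x \<and> x \<le> v \<and> v - u < d \<and> f v - f u \<le> c * (v - u)"
      if "x \<in> S" "d > 0" for x d
      using that by (intro slope_le) (auto simp: S_def)
    obtain D T where D: "D division_of \<Union>D" "\<Union>D \<subseteq> {a<..<b}"
        "\<And>K. K \<in> D \<Longrightarrow> \<exists>u v. K = {u..v} \<and> u < v \<and> f v - f u \<le> c * (v - u)"
        "T \<in> lmeasurable" "measure lebesgue T < \<epsilon>" "S \<subseteq> \<Union>D \<union> T"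
      using finite_Vitali_cover[OF ab S fineS \<epsilon>(1)] by metis
    have I: "{{a..b}} division_of \<Union>{{a..b}}"
      using division_of_self[of a b] \<open>a \<le> b\<close> by simp
    have neD: "interior K \<noteq> {}" if "K \<in> D" for K
      using D(3)[OF that] by auto
    obtain R where R: "R division_of \<Union>R" "\<Union>R \<subseteq> {a..b}"
      "\<And>g::real \<Rightarrow> real. (\<Sum>K\<in>{{a..b}}. increment g K) = (\<Sum>K\<in>D. increment g K) + (\<Sum>K\<in>R. increment g K)"
      by (rule nested_division_remainder[OF I _ \<open>a \<le> b\<close> D(1) _ neD])
        (use D(2) in auto)
    define lD where "lD = (\<Sum>K\<in>D. increment (\<lambda>x. x) K)"
    define lR where "lR = (\<Sum>K\<in>R. increment (\<lambda>x. x) K)"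
    have l_eq: "b - a = lD + lR"
      using R(3)[of "\<lambda>x. x"] \<open>a \<le> b\<close> by (simp add: lD_def lR_def)
    have f_eq: "f b - f a = (\<Sum>K\<in>D. increment f K) + (\<Sum>K\<in>R. increment f K)"
      using R(3)[of f] \<open>a \<le> b\<close> by simp
    have m: "\<Union>D \<in> lmeasurable" "T \<in> lmeasurable" "N \<in> lmeasurable"
      using D negN by (auto dest: lmeasurable_division simp: negligible_imp_measurable)
    have "b - a = measure lebesgue {a..b}" using \<open>a \<le> b\<close> by simp
    also have "\<dots> \<le> measure lebesgue (\<Union>D \<union> (T \<union> N))"
      using m cov D(6) by (intro measure_mono_fmeasurable fmeasurable.Un) auto
    also have "\<dots> \<le> measure lebesgue (\<Union>D) + measure lebesgue (T \<union> N)"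
      using m by (intro measure_Un_le) auto
    also have "measure lebesgue (T \<union> N) \<le> measure lebesgue T + measure lebesgue N"
      using m by (intro measure_Un_le) auto
    finally have "b - a < lD + \<epsilon>"
      using D(5) negligible_imp_measure0[OF negN] sum_length_division[OF D(1)] by (simp add: lD_def)
    then have lR: "0 \<le> lR" "lR < \<epsilon>"
      using l_eq by (auto simp: lR_def sum_length_division[OF R(1)])
    have "(\<Sum>K\<in>D. increment f K) \<le> (\<Sum>K\<in>D. c * increment (\<lambda>x. x) K)"
      by (rule sum_mono) (use D(3) in fastforce)
    then have fD: "(\<Sum>K\<in>D. increment f K) \<le> c * lD"
      by (simp add: lD_def sum_distrib_left)
    have fR: "(\<Sum>K\<in>R. increment f K) \<le> e / 2"
      using d[OF R(1,2)] lR(2) \<epsilon>(2) sum_abs[of "increment f" R] unfolding lR_def by linarith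
    have "- c * lR \<le> (\<bar>c\<bar> + 1) * \<epsilon>"
      using lR by (intro mult_mono) auto
    also have "\<dots> \<le> e / 2"
      using \<epsilon>(3) by (simp add: field_simps)
    finally have "- c * lR \<le> e / 2" .
    moreover have "c * lD = c * (b - a) - c * lR"
      by (simp add: l_eq algebra_simps)
    ultimately show ?thesis using f_eq fD fR by simp
  qed
  show ?thesis
    by (rule field_le_epsilon) (rule main)
qed simp

lemma abs_continuous_on_uminus:
  "abs_continuous_on S f \<Longrightarrow> abs_continuous_on S (\<lambda>x. - f x)"
  unfolding abs_continuous_on_def by (simp add: abs_minus_commute)

text \<open>The inequality is additive over adjacent intervals, so Bolzano's principle reduces it to
  short ones, where bounded variation is immediate. Finally \<open>c\<close> decreases to
  \<open>L\<close>.\<close>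

lemma abs_continuous_increment_le:
  fixes f :: "real \<Rightarrow> real"
  assumes ac: "\<And>a b. abs_continuous_on {a..b} f"
    and der: "\<And>x. f differentiable (at x) \<Longrightarrow> deriv f x \<le> L"
    and "a \<le> b"
  shows "f b - f a \<le> L * (b - a)"
proof -
  have c: "f b - f a \<le> c * (b - a)" if "L < c" for c
    using \<open>a \<le> b\<close>
  proof (induction a b rule: Bolzano)
    case (trans a b c)
    then show ?case by (simp add: algebra_simps)
  next
    case (local x)
    \<comment> \<open>With tolerance \<open>1\<close>, every division inside an interval shorter
      than \<open>d\<close> has variation below \<open>1\<close>, which supplies the bound
      \<open>B = 1\<close>.\<close>
    obtain d where "d > 0" and d: "\<And>D. \<lbrakk>D division_of \<Union>D; \<Union>D \<subseteq> {x - 1..x + 1};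
        (\<Sum>K\<in>D. increment (\<lambda>x. x) K) < d\<rbrakk> \<Longrightarrow> (\<Sum>K\<in>D. \<bar>increment f K\<bar>) < 1"
      by (rule abs_continuous_on_sum_increment[OF ac zero_less_one]) (rule that, assumption+)
    have "f b - f a \<le> c * (b - a)" if ab: "a \<le> x" "x \<le> b" "b - a < min d 1" for a b
    proof (rule bounded_variation_increment_le[OF ac _ _ der \<open>L < c\<close>])
      show "a \<le> b" using ab by simp
      fix D assume D: "D division_of \<Union>D" "\<Union>D \<subseteq> {a..b}"
      have "(\<Sum>K\<in>D. increment (\<lambda>x. x) K) = measure lebesgue (\<Union>D)"
        by (rule sum_length_division[OF D(1)])
      also have "\<dots> \<le> measure lebesgue {a..b}"
        using D by (intro measure_mono_fmeasurable) (auto dest: lmeasurable_division)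
      also have "\<dots> < d" using ab by auto
      finally show "(\<Sum>K\<in>D. \<bar>increment f K\<bar>) \<le> 1"
        using d[OF D(1)] D(2) ab by fastforce
    qed
    then show ?case
      using \<open>d > 0\<close> by (intro exI[of _ "min d 1"]) auto
  qed
  show ?thesis
  proof (rule field_le_epsilon)
    fix e :: real assume "e > 0"
    \<comment> \<open>The denominator \<open>b - a + 1\<close> is positive even for
      \<open>a = b\<close>, and the excess \<open>e * (b - a) / (b - a + 1)\<close> stays below
      \<open>e\<close>.\<close>
    have "f b - f a \<le> (L + e / (b - a + 1)) * (b - a)"
      using \<open>e > 0\<close> \<open>a \<le> b\<close> by (intro c) (simp add: field_simps)
    also have "\<dots> \<le> L * (b - a) + e"
      using \<open>e > 0\<close> \<open>a \<le> b\<close> by (simp add: field_simps)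
    finally show "f b - f a \<le> L * (b - a) + e" .
  qed
qed

lemma abs_continuous_lipschitz:
  fixes f :: "real \<Rightarrow> real"
  assumes ac: "\<And>a b. abs_continuous_on {a..b} f"
    and der: "\<And>x. f differentiable (at x) \<Longrightarrow> \<bar>deriv f x\<bar> \<le> L"
  shows "\<bar>f x - f y\<bar> \<le> L * \<bar>x - y\<bar>"
proof -
  have der': "deriv (\<lambda>x. - f x) x \<le> L" if "(\<lambda>x. - f x) differentiable (at x)" for x
  proof -
    have "(\<lambda>x. - (- f x)) differentiable (at x)"
      by (rule differentiable_minus[OF that])
    then have df: "f differentiable (at x)" by simp
    then have "(f has_field_derivative deriv f x) (at x)"
      by (simp add: DERIV_deriv_iff_real_differentiable)
    then have "((\<lambda>x. - f x) has_field_derivative - deriv f x) (at x)"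
      by (rule DERIV_minus)
    then show ?thesis using der[OF df] by (simp add: DERIV_imp_deriv)
  qed
  have "\<bar>f b - f a\<bar> \<le> L * (b - a)" if "a \<le> b" for a b
    using abs_continuous_increment_le[OF ac _ that, of L] der
      abs_continuous_increment_le[OF abs_continuous_on_uminus[OF ac] der' that]
    by (fastforce simp: abs_le_iff)
  from this[of x y] this[of y x] show ?thesis
    by (cases "x \<le> y") (auto simp: abs_minus_commute)
qed

section \<open>The exponential distribution\<close>

abbreviation exp_measure :: "real measure" where
  "exp_measure \<equiv> density lborel (exponential_density 1)"

text \<open>Presents \<open>exp_measure\<close> as the law of the identity, so that facts on
  exponential random variables yield its tails and moments.\<close>

lemma distributed_exp_measure: "distributed exp_measure lborel (\<lambda>x. x) (exponential_density 1)"
proof -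
  have "distr exp_measure lborel (\<lambda>x. x) = distr exp_measure exp_measure (\<lambda>x. x)"
    by (rule distr_cong) auto
  then show ?thesis
    by (auto simp: distributed_def exponential_density_nonneg)
qed

interpretation exp_measure: prob_space exp_measure
  by (rule prob_space_exponential_density) simp

lemma exp_measure_tail:
  assumes "0 \<le> c" shows "measure exp_measure {c<..} = exp (- c)"
  using exp_measure.exponential_distributedD_gt[OF distributed_exp_measure assms]
  by (simp add: greaterThan_def)

lemma integrable_exp_measure_power [simp]: "integrable exp_measure (\<lambda>y. y ^ i)"
  using exp_measure.erlang_ith_moment_integrable[OF zero_less_one distributed_exp_measure] by simp

lemma exp_measure_moment: "(\<integral>y. y ^ i \<partial>exp_measure) = fact i"
  using exp_measure.erlang_ith_moment[OF zero_less_one distributed_exp_measure, of i] by simp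

lemma integrable_exp_measure_id [simp]: "integrable exp_measure (\<lambda>y. y)"
  using integrable_exp_measure_power[of 1] by simp

lemma exp_measure_mean: "(\<integral>y. y \<partial>exp_measure) = 1"
  using exp_measure_moment[of 1] by simp

lemma AE_exp_measure_nonneg: "AE y in exp_measure. 0 \<le> y"
  by (subst AE_density) (auto simp: exponential_density_def)

lemma integrable_exp_measure_step [simp]:
  "integrable exp_measure (\<lambda>y. \<Sum>k<(n::nat). indicator {c k<..} y * (d k :: real))"
  by (intro Bochner_Integration.integrable_sum integrable_mult_left) (simp_all add: less_top[symmetric])

lemma exp_measure_step:
  assumes "\<And>k. 0 \<le> c k"
  shows "(\<integral>y. (\<Sum>k<(n::nat). indicator {c k<..} y * d k) \<partial>exp_measure) = (\<Sum>k<n. exp (- c k) * d k)"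
proof -
  have int: "integrable exp_measure (\<lambda>y. indicator {c k<..} y * d k)" for k
    by (intro integrable_mult_left) (simp_all add: less_top[symmetric])
  have "(\<integral>y. indicator {c k<..} y * d k \<partial>exp_measure) = exp (- c k) * d k" for k
    by (simp add: exp_measure_tail assms)
  then show ?thesis
    by (simp only: Bochner_Integration.integral_sum[OF int])
qed

text \<open>As \<open>W\<close> is monotone, the thresholds below \<open>y\<close> form an initial
  segment. Its length \<open>K\<close> is the same for all weights \<open>d\<close>, so step
  functions with different jumps are evaluated at one grid point. The cases \<open>K = 0\<close> and
  \<open>K = N\<close> mark the ends, where one side has no tested threshold.\<close>

lemma step_threshold:
  fixes W :: "nat \<Rightarrow> real"
  assumes "mono W"
  obtains K where "K \<le> N" "\<And>d :: nat \<Rightarrow> real. (\<Sum>k<N. indicator {W (Suc k)<..} y * d k) = (\<Sum>k<K. d k)"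
    "K = 0 \<or> W K < y" "K = N \<or> y \<le> W (Suc K)"
proof -
  have "\<exists>K\<le>N. (\<forall>d :: nat \<Rightarrow> real. (\<Sum>k<N. indicator {W (Suc k)<..} y * d k) = (\<Sum>k<K. d k)) \<and>
    (K = 0 \<or> W K < y) \<and> (K = N \<or> y \<le> W (Suc K))"
  proof (induction N)
    case (Suc N)
    then obtain K where K: "K \<le> N"
      "\<And>d :: nat \<Rightarrow> real. (\<Sum>k<N. indicator {W (Suc k)<..} y * d k) = (\<Sum>k<K. d k)"
      "K = 0 \<or> W K < y" "K = N \<or> y \<le> W (Suc K)" by blast
    show ?case
    proof (cases "W (Suc N) < y")
      case True
      have "W (Suc K) \<le> W (Suc N)" using K(1) assms by (auto dest: monoD)
      then have "K = N" using K(4) True by auto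
      then show ?thesis using K True by (intro exI[of _ "Suc N"]) auto
    next
      case False
      then show ?thesis using K by (intro exI[of _ K]) auto
    qed
  qed simp
  then show ?thesis using that by blast
qed

section \<open>The Bernoulli-Laplace spectrum\<close>

text \<open>With \<open>i = n - k\<close> one has \<open>n * lambda_BL n i + 1 = k (k + 1) / n = BL_val n k\<close>,
  and \<open>pi_BL\<close> telescopes, so \<open>BL_tail n k\<close> is the probability that \<open>W \<ge> BL_val n k\<close>.\<close>
definition BL_tail :: "nat \<Rightarrow> nat \<Rightarrow> real" where
  "BL_tail n k = (if k \<le> n then real ((2*n) choose (n - k)) / real ((2*n) choose n) else 0)"

definition BL_val :: "nat \<Rightarrow> nat \<Rightarrow> real" where
  "BL_val n k = real k * (real k + 1) / real n"

lemma BL_val_0 [simp]: "BL_val n 0 = 0"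
  by (simp add: BL_val_def)

lemma BL_tail_0 [simp]: "BL_tail n 0 = 1"
  by (simp add: BL_tail_def)

lemma mono_BL_val: "mono (BL_val n)"
  unfolding BL_val_def by (intro monoI divide_right_mono mult_mono) auto

lemma BL_val_diff: "BL_val n (Suc k) - BL_val n k = 2 * (real k + 1) / real n"
  by (simp add: BL_val_def algebra_simps flip: diff_divide_distrib)

lemma pi_BL_eq_tail_diff:
  assumes "k \<le> n"
  shows "pi_BL n (n - k) = BL_tail n k - BL_tail n (Suc k)"
  using assms by (auto simp: pi_BL_def BL_tail_def diff_divide_distrib)

lemma lambda_BL_eq_val:
  assumes "1 \<le> n" "k \<le> n"
  shows "real n * lambda_BL n (n - k) + 1 = BL_val n k"
  using assms by (simp add: lambda_BL_def BL_val_def field_simps power2_eq_square)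

section \<open>Summation by parts and the mean of W\<close>

lemma sum_by_parts_tail:
  fixes p g :: "nat \<Rightarrow> real"
  shows "(\<Sum>k\<le>N. (p k - p (Suc k)) * g k)
    = p 0 * g 0 - p (Suc N) * g N + (\<Sum>k<N. p (Suc k) * (g (Suc k) - g k))"
  by (induction N) (simp_all add: algebra_simps)

text \<open>Reversing the index by \<open>i = n - k\<close> makes the values increase and turns
  \<open>pi_BL\<close> into differences of tails; the boundary term vanishes as
  \<open>BL_tail n (Suc n) = 0\<close>.\<close>

lemma BL_expectation:
  assumes "1 \<le> n"
  shows "(\<Sum>i\<le>n. pi_BL n i * h (real n * lambda_BL n i + 1))
    = h 0 + (\<Sum>k<n. BL_tail n (Suc k) * (h (BL_val n (Suc k)) - h (BL_val n k)))"
proof -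
  have "(\<Sum>i\<le>n. pi_BL n i * h (real n * lambda_BL n i + 1))
      = (\<Sum>k\<le>n. pi_BL n (n - k) * h (real n * lambda_BL n (n - k) + 1))"
    by (rule sum.reindex_bij_witness[of _ "\<lambda>k. n - k" "\<lambda>k. n - k"]) auto
  also have "\<dots> = (\<Sum>k\<le>n. (BL_tail n k - BL_tail n (Suc k)) * h (BL_val n k))"
    using assms by (intro sum.cong refl) (simp add: pi_BL_eq_tail_diff lambda_BL_eq_val)
  also have "\<dots> = h 0 + (\<Sum>k<n. BL_tail n (Suc k) * (h (BL_val n (Suc k)) - h (BL_val n k)))"
    by (subst sum_by_parts_tail) (simp add: BL_tail_def[of n "Suc n"])
  finally show ?thesis .
qed

text \<open>This is \<open>(j + 1) C(2n, j + 1) = (2n - j) C(2n, j)\<close> at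
  \<open>j = n - k - 1\<close>; for \<open>k = n\<close> both sides are zero.\<close>

lemma BL_tail_Suc:
  assumes "k \<le> n"
  shows "(real n + real k + 1) * BL_tail n (Suc k) = (real n - real k) * BL_tail n k"
proof (cases "k = n")
  case False
  then obtain j where j: "n = Suc (k + j)"
    using assms by (metis le_neq_implies_less less_iff_Suc_add)
  have "Suc j * ((2 * n) choose Suc j) = (2 * n - j) * ((2 * n) choose j)"
    by (metis binomial_absorb_comp binomial_absorption)
  moreover have "2 * n - j = n + k + 1" "n - k = Suc j" "n - Suc k = j"
    using j by auto
  ultimately have "(n + k + 1) * ((2 * n) choose (n - Suc k)) = (n - k) * ((2 * n) choose (n - k))"
    by simp
  then have "real ((n + k + 1) * ((2 * n) choose (n - Suc k))) = real ((n - k) * ((2 * n) choose (n - k)))"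
    by (rule arg_cong)
  then have "(real n + real k + 1) * real ((2 * n) choose (n - Suc k)) = (real n - real k) * real ((2 * n) choose (n - k))"
    using assms by (simp only: of_nat_mult of_nat_add of_nat_diff of_nat_1)
  then show ?thesis
    using j by (simp add: BL_tail_def del: binomial_Suc_Suc)
qed (simp add: BL_tail_def)

text \<open>The identity \<open>E W = 1\<close>: by the ratio of consecutive tails, the partial sums
  telescope.\<close>

lemma sum_BL_tail:
  assumes "1 \<le> n"
  shows "(\<Sum>k<n. BL_tail n (Suc k) * (BL_val n (Suc k) - BL_val n k)) = 1"
proof -
  have "(\<Sum>k<N. BL_tail n (Suc k) * (2 * (real k + 1))) = real n - (real n - real N) * BL_tail n N"
    if "N \<le> n" for N
    using that
  proof (induction N)
    case (Suc N)
    then show ?case using BL_tail_Suc[of N n] by (simp add: algebra_simps)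
  qed simp
  from this[of n] show ?thesis
    using assms by (simp add: BL_val_diff flip: sum_divide_distrib)
qed

section \<open>Gaussian majorants of the tails\<close>

text \<open>Bounds \<open>(1 - x) / (1 + x)\<close>, the form taken by the ratio of consecutive
  tails. Multiplied by \<open>exp x\<close>, the inequality says that \<open>g\<close> is
  nonnegative, and \<open>g\<close> increases from \<open>0\<close>.\<close>

lemma one_minus_le_exp:
  fixes x :: real
  assumes "0 \<le> x"
  shows "1 - x \<le> (1 + x) * exp (- 2 * x)"
proof -
  define g where "g x = (1 + x) * exp (- x) - (1 - x) * exp x" for x :: real
  have "g 0 \<le> g x"
  proof (rule DERIV_nonneg_imp_nondecreasing[OF assms])
    fix t :: real assume t: "0 \<le> t" "t \<le> x"
    have "(g has_real_derivative t * (exp t - exp (- t))) (at t)"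
      unfolding g_def by (auto intro!: derivative_eq_intros simp: algebra_simps)
    moreover have "0 \<le> t * (exp t - exp (- t))" using t by simp
    ultimately show "\<exists>y. (g has_real_derivative y) (at t) \<and> 0 \<le> y" by blast
  qed
  then have "(1 - x) * exp x \<le> (1 + x) * exp (- x)" by (simp add: g_def)
  then have "(1 - x) * exp x * exp (- x) \<le> (1 + x) * exp (- x) * exp (- x)"
    by (rule mult_right_mono) simp
  then show ?thesis by (simp add: mult.assoc flip: exp_add)
qed

lemma BL_tail_nonneg: "0 \<le> BL_tail n k"
  by (simp add: BL_tail_def)

lemma BL_tail_le:
  assumes "k \<le> n"
  shows "BL_tail n k \<le> exp (- (real k)\<^sup>2 / (real n + 1/2))"
  using assms
proof (induction k)
  case (Suc k)
  define m where "m = real n + 1/2"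
  \<comment> \<open>The tail ratio is \<open>(1 - x) / (1 + x)\<close>, and
    \<open>2 * x = (2 * k + 1) / m\<close> is exactly the step from \<open>k^2 / m\<close> to
    \<open>(k + 1)^2 / m\<close>; this dictates \<open>m = n + 1/2\<close>.\<close>
  define x where "x = (real k + 1/2) / m"
  have m: "m > 0" by (simp add: m_def)
  have "x * m = real k + 1/2" using m by (simp add: x_def)
  then have x: "(1 - x) * m = real n - real k" "(1 + x) * m = real n + real k + 1"
    by (simp_all add: left_diff_distrib distrib_right m_def)
  have pos: "0 < real n + real k + 1" by simp
  have "real n - real k \<le> (real n + real k + 1) * exp (- 2 * x)"
    using mult_right_mono[OF one_minus_le_exp[of x], of m] m
    unfolding x(1) x(2)[symmetric] by (simp add: x_def mult_ac)
  then have "(real n - real k) * BL_tail n k \<le> (real n + real k + 1) * exp (- 2 * x) * BL_tail n k"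
    by (rule mult_right_mono) (rule BL_tail_nonneg)
  then have "(real n + real k + 1) * BL_tail n (Suc k) \<le> (real n + real k + 1) * (exp (- 2 * x) * BL_tail n k)"
    using BL_tail_Suc[of k n] Suc.prems by (simp add: mult.assoc)
  then have "BL_tail n (Suc k) \<le> exp (- 2 * x) * BL_tail n k"
    using pos by (simp only: mult_le_cancel_left_pos)
  also have "\<dots> \<le> exp (- 2 * x) * exp (- (real k)\<^sup>2 / m)"
    using Suc by (intro mult_left_mono) (auto simp: m_def)
  also have "\<dots> = exp (- (real (Suc k))\<^sup>2 / m)"
    using m by (simp add: x_def field_simps power2_eq_square flip: exp_add)
  finally show ?case by (simp add: m_def)
qed simp

lemma exp_BL_val_le:
  assumes "1 \<le> n"
  shows "exp (- BL_val n k) \<le> exp (- (real k)\<^sup>2 / (real n + 1/2))"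
proof -
  have "(real k)\<^sup>2 / (real n + 1/2) \<le> (real k)\<^sup>2 / real n"
    using assms by (intro divide_left_mono) auto
  also have "\<dots> \<le> BL_val n k"
    unfolding BL_val_def by (intro divide_right_mono) (auto simp: power2_eq_square algebra_simps)
  finally show ?thesis by simp
qed

text \<open>The sum is an expectation under the exponential law: each Gaussian weight is a tail probability.\<close>
lemma sum_gaussian_le:
  assumes "m > 0"
  shows "(\<Sum>k<n. exp (- (real (Suc k))\<^sup>2 / m) * (2 * (real k + 1))) \<le> m + sqrt m"
proof -
  define c where "c k = (real k)\<^sup>2 / m" for k
  have c: "mono c" unfolding c_def using assms by (intro monoI divide_right_mono power_mono) auto
  have pt: "(\<Sum>k<n. indicator {c (Suc k)<..} y * (2 * (real k + 1))) \<le> m * y + sqrt m * (1 + y) / 2"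
    if y: "0 \<le> y" for y
  proof -
    obtain K where K: "\<And>d :: nat \<Rightarrow> real. (\<Sum>k<n. indicator {c (Suc k)<..} y * d k) = (\<Sum>k<K. d k)"
      "K = 0 \<or> c K < y"
      using step_threshold[OF c, of n y] by metis
    have "(\<Sum>k<K. 2 * (real k + 1)) = (real K)\<^sup>2 + real K"
      by (induction K) (simp_all add: power2_eq_square algebra_simps)
    moreover have Ky: "(real K)\<^sup>2 \<le> m * y"
      using K(2) y assms by (auto simp: c_def field_simps)
    \<comment> \<open>The arithmetic-geometric mean inequality replaces \<open>sqrt y\<close> by a
      bound linear in \<open>y\<close>, so that only the mean of \<open>Y\<close> enters.\<close>
    moreover have "real K \<le> sqrt m * (1 + y) / 2"
    proof -
      have "2 * real K * sqrt m \<le> (real K)\<^sup>2 + (sqrt m)\<^sup>2"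
        by (rule sum_squares_bound)
      also have "\<dots> \<le> (sqrt m * (1 + y)) * sqrt m"
        using Ky assms by (simp add: algebra_simps)
      finally have "2 * real K \<le> sqrt m * (1 + y)"
        using assms by (simp only: mult_le_cancel_right_pos real_sqrt_gt_zero)
      then show ?thesis by simp
    qed
    ultimately show ?thesis by (simp add: K(1))
  qed
  have "(\<Sum>k<n. exp (- c (Suc k)) * (2 * (real k + 1)))
      = (\<integral>y. (\<Sum>k<n. indicator {c (Suc k)<..} y * (2 * (real k + 1))) \<partial>exp_measure)"
    using assms by (subst exp_measure_step) (auto simp: c_def)
  also have "\<dots> \<le> (\<integral>y. m * y + sqrt m * (1 + y) / 2 \<partial>exp_measure)"
  proof (rule integral_mono_AE[OF integrable_exp_measure_step])
    show "AE y in exp_measure. (\<Sum>k<n. indicator {c (Suc k)<..} y * (2 * (real k + 1)))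
        \<le> m * y + sqrt m * (1 + y) / 2"
      using AE_exp_measure_nonneg by (rule eventually_mono) (rule pt)
  qed simp
  also have "\<dots> = m + sqrt m"
    by (simp add: exp_measure_mean exp_measure.prob_space[simplified])
  finally show ?thesis by (simp add: c_def)
qed

section \<open>Rounding the exponential variable down to the grid\<close>

text \<open>The sum is the expectation of \<open>w Y\<close>, where \<open>w y\<close> is
  \<open>y\<close> rounded down to the grid. Between grid points the loss is of order
  \<open>sqrt (y / n)\<close>, bounded by an affine function of \<open>y\<close>; beyond the last
  point \<open>n + 1\<close> a quadratic term controls it.\<close>

lemma sum_exp_BL_val_ge:
  assumes n: "1 \<le> n"
  shows "1 - (2 * sqrt (real n + 1/4) + 1) / real n - 1 / (2 * (real n + 1))
    \<le> (\<Sum>k<n. exp (- BL_val n (Suc k)) * (BL_val n (Suc k) - BL_val n k))"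
proof -
  \<comment> \<open>With this weight \<open>(n * Y + 1/4) / s + s\<close> has mean
    \<open>2 * s\<close>, because \<open>n * Y + 1/4\<close> has mean \<open>s^2\<close>.\<close>
  define s where "s = sqrt (real n + 1/4)"
  have s: "s > 0" "s\<^sup>2 = real n + 1/4" using n by (auto simp: s_def)
  define w where "w y = (\<Sum>k<n. indicator {BL_val n (Suc k)<..} y * (BL_val n (Suc k) - BL_val n k))" for y
  have pt: "y - ((real n * y + 1/4) / s + s + 1) / real n - y\<^sup>2 / (4 * (real n + 1)) \<le> w y"
    if y: "0 \<le> y" for y
  proof -
    obtain K where K: "K \<le> n" "\<And>d :: nat \<Rightarrow> real. (\<Sum>k<n. indicator {BL_val n (Suc k)<..} y * d k) = (\<Sum>k<K. d k)"
      "K = 0 \<or> BL_val n K < y" "K = n \<or> y \<le> BL_val n (Suc K)"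
      using step_threshold[OF mono_BL_val, of n n y] by metis
    have w: "w y = BL_val n K"
      unfolding w_def K(2) by (simp add: sum_lessThan_telescope)
    have rest: "0 \<le> (real n * y + 1/4) / s + s + 1" "0 \<le> y\<^sup>2 / (4 * (real n + 1))"
      using y s by auto
    show ?thesis
    proof (cases "K = n")
      case True
      have "0 \<le> (y - 2 * (real n + 1))\<^sup>2" by simp
      then have "(y - (real n + 1)) * (4 * (real n + 1)) \<le> y\<^sup>2"
        by (simp add: power2_eq_square algebra_simps)
      then have "y - (real n + 1) \<le> y\<^sup>2 / (4 * (real n + 1))"
        by (simp add: pos_le_divide_eq)
      moreover have "w y = real n + 1" using True n by (simp add: w BL_val_def)
      moreover have "0 \<le> ((real n * y + 1/4) / s + s + 1) / real n" using rest(1) by simp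
      ultimately show ?thesis by linarith
    next
      case False
      then have ub: "real n * y \<le> (real K + 1) * (real K + 2)"
        using K(4) n by (simp add: BL_val_def field_simps)
      have lb: "real K * (real K + 1) \<le> real n * y"
        using K(3) n y by (auto simp: BL_val_def field_simps)
      \<comment> \<open>The loss times \<open>n\<close> is at most the gap
        \<open>2 * (K + 1) = 2 * (K + 1/2) + 1\<close>, and
        \<open>(K + 1/2)^2 = K * (K + 1) + 1/4\<close> is at most
        \<open>n * y + 1/4\<close>.\<close>
      have "2 * (real K + 1/2) * s \<le> (real K + 1/2)\<^sup>2 + s\<^sup>2"
        by (rule sum_squares_bound)
      also have "\<dots> \<le> (real n * y + 1/4) + s * s"
        using lb by (simp add: power2_eq_square algebra_simps)
      finally have "2 * (real K + 1/2) \<le> (real n * y + 1/4) / s + s"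
        using s(1) by (simp add: field_simps)
      then have "real n * y - real K * (real K + 1) \<le> (real n * y + 1/4) / s + s + 1"
        using ub by (simp add: algebra_simps)
      then have "(real n * y - real K * (real K + 1)) / real n \<le> ((real n * y + 1/4) / s + s + 1) / real n"
        by (rule divide_right_mono) simp
      moreover have "(real n * y - real K * (real K + 1)) / real n = y - w y"
        using n by (simp add: w BL_val_def diff_divide_distrib)
      ultimately show ?thesis using rest(2) by linarith
    qed
  qed
  have "1 - (2 * s + 1) / real n - 1 / (2 * (real n + 1))
      = (\<integral>y. y - ((real n * y + 1/4) / s + s + 1) / real n - y\<^sup>2 / (4 * (real n + 1)) \<partial>exp_measure)"
  proof -
    have "(real n + 1/4) / s = s"
      using s by (simp add: power2_eq_square field_simps)
    moreover have "1 / (2 * (real n + 1)) = 2 / (4 * (real n + 1))"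
      by (simp add: field_simps)
    ultimately show ?thesis
      by (simp add: exp_measure_mean exp_measure_moment exp_measure.prob_space[simplified])
  qed
  also have "\<dots> \<le> (\<integral>y. w y \<partial>exp_measure)"
  proof (rule integral_mono_AE)
    show "integrable exp_measure w"
      unfolding w_def[abs_def] by (rule integrable_exp_measure_step)
    show "AE y in exp_measure.
        y - ((real n * y + 1/4) / s + s + 1) / real n - y\<^sup>2 / (4 * (real n + 1)) \<le> w y"
      using AE_exp_measure_nonneg by (rule eventually_mono) (rule pt)
  qed simp
  also have "\<dots> = (\<Sum>k<n. exp (- BL_val n (Suc k)) * (BL_val n (Suc k) - BL_val n k))"
    unfolding w_def by (rule exp_measure_step) (simp add: BL_val_def)
  finally show ?thesis by (simp add: s_def)
qed

text \<open>The sum is the expectation of \<open>h (w Y) - h 0\<close>, with \<open>w y\<close> the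
  rounding of \<open>y\<close> down to the grid. The Lipschitz bound gives an error of at most
  \<open>L * (y - w y)\<close>, which is then integrated.\<close>

lemma exp_expectation_approx:
  fixes h :: "real \<Rightarrow> real"
  assumes lip: "\<And>x y. \<bar>h x - h y\<bar> \<le> L * \<bar>x - y\<bar>"
  shows "\<bar>(\<integral>y. h y \<partial>exp_measure) - h 0 - (\<Sum>k<n. exp (- BL_val n (Suc k)) * (h (BL_val n (Suc k)) - h (BL_val n k)))\<bar>
    \<le> L * (1 - (\<Sum>k<n. exp (- BL_val n (Suc k)) * (BL_val n (Suc k) - BL_val n k)))"
proof -
  define T where "T y = (\<Sum>k<n. indicator {BL_val n (Suc k)<..} y * (h (BL_val n (Suc k)) - h (BL_val n k)))" for y
  define w where "w y = (\<Sum>k<n. indicator {BL_val n (Suc k)<..} y * (BL_val n (Suc k) - BL_val n k))" for y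
  have pt: "\<bar>h y - h 0 - T y\<bar> \<le> L * (y - w y)" if y: "0 \<le> y" for y
  proof -
    obtain K where K: "\<And>d :: nat \<Rightarrow> real. (\<Sum>k<n. indicator {BL_val n (Suc k)<..} y * d k) = (\<Sum>k<K. d k)"
      "K = 0 \<or> BL_val n K < y"
      using step_threshold[OF mono_BL_val, of n n y] by metis
    have "T y = h (BL_val n K) - h 0"
      unfolding T_def K(1) using sum_lessThan_telescope[of "\<lambda>k. h (BL_val n k)" K] by simp
    moreover have "w y = BL_val n K"
      unfolding w_def K(1) by (simp add: sum_lessThan_telescope)
    moreover have "BL_val n K \<le> y" using K(2) y by auto
    ultimately show ?thesis using lip[of y "BL_val n K"] by simp
  qed
  have "L-lipschitz_on UNIV h"
  proof (rule lipschitz_onI)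
    show "dist (h x) (h y) \<le> L * dist x y" for x y using lip by (simp add: dist_real_def)
    show "0 \<le> L" using lip[of 1 0] by simp
  qed
  then have "continuous_on UNIV h" by (rule lipschitz_on_continuous_on)
  then have [measurable]: "h \<in> borel_measurable borel" by (rule borel_measurable_continuous_onI)
  have int_h: "integrable exp_measure h"
  proof (rule Bochner_Integration.integrable_bound)
    show "integrable exp_measure (\<lambda>y. \<bar>h 0\<bar> + L * y)" by simp
    have "norm (h y) \<le> norm (\<bar>h 0\<bar> + L * y)" if "0 \<le> y" for y
      using lip[of y 0] that by auto
    then show "AE y in exp_measure. norm (h y) \<le> norm (\<bar>h 0\<bar> + L * y)"
      using AE_exp_measure_nonneg by (auto elim!: eventually_mono)
  qed simp
  have int_T: "integrable exp_measure T" "integrable exp_measure w"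
    unfolding T_def[abs_def] w_def[abs_def] by (rule integrable_exp_measure_step)+
  have "\<bar>\<integral>y. h y - h 0 - T y \<partial>exp_measure\<bar> \<le> (\<integral>y. \<bar>h y - h 0 - T y\<bar> \<partial>exp_measure)"
    by (rule integral_abs_bound)
  also have "\<dots> \<le> (\<integral>y. L * (y - w y) \<partial>exp_measure)"
    using AE_exp_measure_nonneg int_h int_T
    by (intro integral_mono_AE) (auto elim!: eventually_mono simp: pt)
  also have "\<dots> = L * (1 - (\<integral>y. w y \<partial>exp_measure))"
    using int_T by (simp add: exp_measure_mean)
  also have "(\<integral>y. h y - h 0 - T y \<partial>exp_measure) = (\<integral>y. h y \<partial>exp_measure) - h 0 - (\<integral>y. T y \<partial>exp_measure)"
    using int_h int_T by (simp add: exp_measure.prob_space[simplified])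
  also have "(\<integral>y. T y \<partial>exp_measure) = (\<Sum>k<n. exp (- BL_val n (Suc k)) * (h (BL_val n (Suc k)) - h (BL_val n k)))"
    unfolding T_def by (rule exp_measure_step) (simp add: BL_val_def)
  also have "(\<integral>y. w y \<partial>exp_measure) = (\<Sum>k<n. exp (- BL_val n (Suc k)) * (BL_val n (Suc k) - BL_val n k))"
    unfolding w_def by (rule exp_measure_step) (simp add: BL_val_def)
  finally show ?thesis .
qed

section \<open>Assembling the estimate\<close>

text \<open>Each term is at most a multiple of \<open>1 / sqrt n\<close>; the multiples add up to
  \<open>11\<close>.\<close>

lemma BL_numeric_bound:
  assumes "1 \<le> (n::nat)"
  shows "2 * ((real n + 1/2 + sqrt (real n + 1/2)) / real n
     - (1 - (2 * sqrt (real n + 1/4) + 1) / real n - 1 / (2 * (real n + 1)))) \<le> 12 / sqrt (real n)"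
proof -
  define r where "r = sqrt (real n)"
  have r: "r \<ge> 1" "r\<^sup>2 = real n" using assms by (auto simp: r_def)
  have m: "sqrt (real n + 1/2) \<le> 5/4 * r"
    using r assms by (intro real_le_lsqrt) (auto simp: power2_eq_square field_simps)
  have s: "sqrt (real n + 1/4) \<le> 9/8 * r"
    using r assms by (intro real_le_lsqrt) (auto simp: power2_eq_square field_simps)
  have rr: "r \<le> real n" using r by (simp add: power2_eq_square flip: r(2))
  have inv: "1 / real n \<le> 1 / r" using r rr by (intro divide_left_mono) auto
  have inv2: "1 / (2 * (real n + 1)) \<le> 1 / (2 * r)" using r rr by (intro divide_left_mono) auto
  have rn: "r / real n = 1 / r" using r by (simp add: power2_eq_square flip: r(2))
  have m': "sqrt (real n + 1/2) / real n \<le> 5/4 * (1 / r)"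
    using divide_right_mono[OF m, of "real n"] rn by (simp add: mult.assoc flip: times_divide_eq_right)
  have s': "sqrt (real n + 1/4) / real n \<le> 9/8 * (1 / r)"
    using divide_right_mono[OF s, of "real n"] rn by (simp add: mult.assoc flip: times_divide_eq_right)
  have "2 * ((real n + 1/2 + sqrt (real n + 1/2)) / real n
     - (1 - (2 * sqrt (real n + 1/4) + 1) / real n - 1 / (2 * (real n + 1))))
     = 2 * (3/2 * (1 / real n) + sqrt (real n + 1/2) / real n + 2 * (sqrt (real n + 1/4) / real n) + 1 / (2 * (real n + 1)))"
    using assms by (simp add: add_divide_distrib)
  also have "\<dots> \<le> 2 * (3/2 * (1 / r) + 5/4 * (1 / r) + 2 * (9/8 * (1 / r)) + 1/2 * (1 / r))"
    using m' s' inv inv2 by simp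
  also have "\<dots> \<le> 12 / r" using r by (simp add: field_simps)
  finally show ?thesis by (simp add: r_def)
qed

lemma BL_wasserstein_bound:
  fixes h :: "real \<Rightarrow> real"
  assumes n: "1 \<le> n" and lip: "\<And>x y. \<bar>h x - h y\<bar> \<le> L * \<bar>x - y\<bar>"
  shows "\<bar>(\<Sum>i\<le>n. pi_BL n i * h (real n * lambda_BL n i + 1)) - (\<integral>y. h y \<partial>exp_measure)\<bar>
    \<le> 12 * L / sqrt (real n)"
proof -
  define dh where "dh k = h (BL_val n (Suc k)) - h (BL_val n k)" for k
  define dW where "dW k = BL_val n (Suc k) - BL_val n k" for k
  define p where "p k = BL_tail n (Suc k)" for k
  define q where "q k = exp (- BL_val n (Suc k))" for k
  define u where "u k = exp (- (real (Suc k))\<^sup>2 / (real n + 1/2))" for k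
  define Q where "Q = (\<Sum>k<n. q k * dW k)"
  define U where "U = (\<Sum>k<n. u k * dW k)"
  have L: "0 \<le> L" using lip[of 1 0] by simp
  have dW: "0 \<le> dW k" for k by (simp add: dW_def BL_val_diff)
  have dh: "\<bar>dh k\<bar> \<le> L * dW k" for k
    using lip[of "BL_val n (Suc k)" "BL_val n k"] dW[of k] by (simp add: dh_def dW_def)
  have pu: "p k \<le> u k" if "k < n" for k
    using BL_tail_le[of "Suc k" n] that by (simp add: p_def u_def)
  have qu: "q k \<le> u k" for k
    using exp_BL_val_le[OF n, of "Suc k"] by (simp add: q_def u_def)
  have EW: "(\<Sum>i\<le>n. pi_BL n i * h (real n * lambda_BL n i + 1)) = h 0 + (\<Sum>k<n. p k * dh k)"
    unfolding BL_expectation[OF n] p_def dh_def ..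
  have EY: "\<bar>(\<integral>y. h y \<partial>exp_measure) - h 0 - (\<Sum>k<n. q k * dh k)\<bar> \<le> L * (1 - Q)"
    using exp_expectation_approx[OF lip] unfolding q_def dh_def dW_def Q_def .
  have P: "(\<Sum>k<n. p k * dW k) = 1"
    using sum_BL_tail[OF n] unfolding p_def dW_def .
  have "\<bar>(\<Sum>k<n. p k * dh k) - (\<Sum>k<n. q k * dh k)\<bar> = \<bar>\<Sum>k<n. (p k - q k) * dh k\<bar>"
    by (simp add: sum_subtractf left_diff_distrib)
  also have "\<dots> \<le> (\<Sum>k<n. \<bar>p k - q k\<bar> * \<bar>dh k\<bar>)"
    by (rule order_trans[OF sum_abs]) (simp add: abs_mult)
  also have "\<dots> \<le> (\<Sum>k<n. (2 * u k - p k - q k) * (L * dW k))"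
  proof (rule sum_mono)
    fix k assume "k \<in> {..<n}"
    then have "p k \<le> u k" "q k \<le> u k" using pu qu by auto
    then show "\<bar>p k - q k\<bar> * \<bar>dh k\<bar> \<le> (2 * u k - p k - q k) * (L * dW k)"
      using dh by (intro mult_mono) auto
  qed
  also have "\<dots> = L * (2 * U - 1 - Q)"
    unfolding P[symmetric] U_def Q_def
    by (simp add: sum_distrib_left algebra_simps flip: sum_subtractf)
  finally have "\<bar>(\<Sum>k<n. p k * dh k) - (\<Sum>k<n. q k * dh k)\<bar> \<le> L * (2 * U - 1 - Q)" .
  with EY have "\<bar>(\<Sum>i\<le>n. pi_BL n i * h (real n * lambda_BL n i + 1)) - (\<integral>y. h y \<partial>exp_measure)\<bar>
      \<le> L * (1 - Q) + L * (2 * U - 1 - Q)"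
    unfolding EW by linarith
  \<comment> \<open>The rounding error \<open>1 - Q\<close> and the comparison error
    \<open>2 * U - 1 - Q\<close> add up so that the mean \<open>1\<close> cancels, leaving an upper
    bound for \<open>U\<close> and a lower bound for \<open>Q\<close> to insert.\<close>
  also have "\<dots> = L * (2 * (U - Q))" by (simp add: algebra_simps)
  also have "\<dots> \<le> L * (12 / sqrt (real n))"
  proof (rule mult_left_mono[OF _ L])
    have "U = (\<Sum>k<n. u k * (2 * (real k + 1))) / real n"
      by (simp add: U_def dW_def BL_val_diff sum_divide_distrib)
    also have "\<dots> \<le> (real n + 1/2 + sqrt (real n + 1/2)) / real n"
      unfolding u_def by (intro divide_right_mono sum_gaussian_le) auto
    finally have "U \<le> (real n + 1/2 + sqrt (real n + 1/2)) / real n" .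
    moreover have "1 - (2 * sqrt (real n + 1/4) + 1) / real n - 1 / (2 * (real n + 1)) \<le> Q"
      using sum_exp_BL_val_ge[OF n] by (simp add: Q_def q_def dW_def)
    ultimately show "2 * (U - Q) \<le> 12 / sqrt (real n)"
      by (intro order_trans[OF mult_left_mono[OF diff_mono] BL_numeric_bound[OF n]]) auto
  qed
  finally show ?thesis by (simp add: mult.commute)
qed

theorem theorem3p2:
  fixes n :: nat and h :: "real \<Rightarrow> real" and L :: real
  assumes n: "n \<ge> 1"
    and ac: "\<And>a b. abs_continuous_on {a..b} h"
    and bd: "\<And>x. h differentiable (at x) \<Longrightarrow> \<bar>deriv h x\<bar> \<le> L"
  shows "\<bar>(\<Sum>i\<le>n. pi_BL n i * h (real n * lambda_BL n i + 1))
          - (\<integral>y. h y \<partial>(density lborel (exponential_density 1)))\<bar>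
         \<le> 12 * L / sqrt (real n)"
  by (rule BL_wasserstein_bound[OF n abs_continuous_lipschitz[OF ac bd]])

end
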